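(* Let $\boldsymbol{X}=(X_1,\ldots,X_n)$ be a random sample from the BN$(\mu,\sigma,\alpha)$ distribution. If the parameters $\sigma>0$ and $\alpha\in\mathbb{R}$ are known, then the equation $\partial l(\boldsymbol{\theta};\boldsymbol{X})/\partial\mu=0$ in the unknown $\mu$, that is, $$\frac n\sigma\left(\frac{\overline X-\mu}{\sigma}\right)-\frac\alpha\sigma\sum_{i=1}^n\tanh\left[\alpha\left(\frac{X_i-\mu}{\sigma}\right)\right]=0,$$ has at least one root on the interval $(-\infty,+\infty)$.
   Context: BN$(\boldsymbol{\theta})$, $\boldsymbol{\theta}=(\mu,\sigma,\alpha)$ with $\mu\in\mathbb{R}$, $\sigma>0$, $\alpha\in\mathbb{R}$, is the distribution on $\mathbb{R}$ with PDF $$f(x;\boldsymbol{\theta})=\frac{1}{\sqrt{2\pi\sigma^2}}\exp\left[-\frac12\left(\frac{x-\mu}{\sigma}\right)^2-\frac{\alpha^2}{2}\right]\cosh\left[\alpha\left(\frac{x-\mu}{\sigma}\right)\right],\quad x\in\mathbb{R}.$$ The log-likelihood function is $l(\boldsymbol{\theta};\boldsymbol{X})=\sum_{i=1}^n\log f(X_i;\boldsymbol{\theta})$, and $\overline X=\frac1n\sum_{i=1}^n X_i$. *)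

theory Defs
  imports "HOL-Probability.Probability"
begin

definition bn_density :: "real \<Rightarrow> real \<Rightarrow> real \<Rightarrow> real \<Rightarrow> real" where
  "bn_density \<mu> \<sigma> \<alpha> x =
     1 / sqrt (2 * pi * \<sigma>\<^sup>2) * exp (- (1 / 2) * ((x - \<mu>) / \<sigma>)\<^sup>2 - \<alpha>\<^sup>2 / 2)
       * cosh (\<alpha> * ((x - \<mu>) / \<sigma>))"

definition bn_random_sample ::
    "'a measure \<Rightarrow> nat \<Rightarrow> real \<Rightarrow> real \<Rightarrow> real \<Rightarrow> (nat \<Rightarrow> 'a \<Rightarrow> real) \<Rightarrow> bool" where
  "bn_random_sample M n \<mu> \<sigma> \<alpha> X \<longleftrightarrow>
     prob_space M \<and>
     prob_space.indep_vars M (\<lambda>_. borel) X {1..n} \<and>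
     (\<forall>i\<in>{1..n}. distributed M lborel (X i) (\<lambda>x. ennreal (bn_density \<mu> \<sigma> \<alpha> x)))"

definition bn_loglik :: "nat \<Rightarrow> real \<Rightarrow> real \<Rightarrow> real \<Rightarrow> (nat \<Rightarrow> real) \<Rightarrow> real" where
  "bn_loglik n \<mu> \<sigma> \<alpha> x = (\<Sum>i=1..n. ln (bn_density \<mu> \<sigma> \<alpha> (x i)))"

definition sample_mean :: "nat \<Rightarrow> (nat \<Rightarrow> real) \<Rightarrow> real" where
  "sample_mean n x = 1 / real n * (\<Sum>i=1..n. x i)"

(* Closed form of the partial derivative of bn_loglik in \<mu>. *)
definition bn_score_mu :: "nat \<Rightarrow> real \<Rightarrow> real \<Rightarrow> real \<Rightarrow> (nat \<Rightarrow> real) \<Rightarrow> real" where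
  "bn_score_mu n \<mu> \<sigma> \<alpha> x =
     real n / \<sigma> * ((sample_mean n x - \<mu>) / \<sigma>)
       - \<alpha> / \<sigma> * (\<Sum>i=1..n. tanh (\<alpha> * ((x i - \<mu>) / \<sigma>)))"

end

theory Submission imports Defs begin

text \<open>
  The sum of the hyperbolic tangents lies between $-n$ and $n$, so the linear part of the score
  dominates at $\overline X \mp \sigma|\alpha|$: the score is nonnegative at the left point and
  nonpositive at the right one, and the intermediate value theorem yields a root between them.
\<close>

text \<open>All three factors of the density are positive, so the logarithm of the product splits.
  This isolates the normalising constant, which does not depend on \<mu>.\<close>

lemma ln_bn_density:
  assumes "\<sigma> > 0"
  shows "ln (bn_density \<mu> \<sigma> \<alpha> x) =
    ln (1 / sqrt (2 * pi * \<sigma>\<^sup>2)) + (- (1 / 2) * ((x - \<mu>) / \<sigma>)\<^sup>2 - \<alpha>\<^sup>2 / 2)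
      + ln (cosh (\<alpha> * ((x - \<mu>) / \<sigma>)))"
proof -
  have "1 / sqrt (2 * pi * \<sigma>\<^sup>2) > 0"
    using assms by simp
  then show ?thesis
    unfolding bn_density_def
    by (simp only: ln_mult_pos mult_pos_pos exp_gt_zero cosh_real_pos ln_exp)
qed

text \<open>The quadratic exponent contributes the linear term. Since the derivative of
  \<open>ln (cosh y)\<close> is \<open>tanh y\<close>, the chain rule with inner derivative
  \<open>- \<alpha> / \<sigma>\<close> contributes the other.\<close>

lemma ln_bn_density_has_derivative:
  assumes "\<sigma> > 0"
  shows "((\<lambda>m. ln (bn_density m \<sigma> \<alpha> x)) has_real_derivative
    (x - \<mu>) / \<sigma>\<^sup>2 - \<alpha> / \<sigma> * tanh (\<alpha> * ((x - \<mu>) / \<sigma>))) (at \<mu>)"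
  unfolding ln_bn_density[OF assms]
  using assms
  by (auto intro!: derivative_eq_intros simp: cosh_real_pos tanh_def field_simps power2_eq_square)

lemma bn_loglik_has_derivative:
  assumes "n \<ge> 1" and "\<sigma> > 0"
  shows "((\<lambda>m. bn_loglik n m \<sigma> \<alpha> x) has_real_derivative bn_score_mu n \<mu> \<sigma> \<alpha> x) (at \<mu>)"
proof -
  have "((\<lambda>m. bn_loglik n m \<sigma> \<alpha> x) has_real_derivative
      (\<Sum>i=1..n. (x i - \<mu>) / \<sigma>\<^sup>2 - \<alpha> / \<sigma> * tanh (\<alpha> * ((x i - \<mu>) / \<sigma>)))) (at \<mu>)"
    unfolding bn_loglik_def using assms(2) by (intro DERIV_sum ln_bn_density_has_derivative)
  \<comment> \<open>The factor \<open>real n\<close> cancels the \<open>1 / real n\<close> inside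
    \<open>sample_mean\<close>.\<close>
  moreover have "(\<Sum>i=1..n. (x i - \<mu>) / \<sigma>\<^sup>2) = real n / \<sigma> * ((sample_mean n x - \<mu>) / \<sigma>)"
    using assms
    by (simp add: sample_mean_def sum_divide_distrib[symmetric] sum_subtractf
        field_simps power2_eq_square)
  ultimately show ?thesis
    by (simp add: bn_score_mu_def sum_subtractf sum_distrib_left)
qed

lemma bn_score_mu_root:
  assumes "\<sigma> > 0"
  shows "\<exists>\<mu>. bn_score_mu n \<mu> \<sigma> \<alpha> x = 0"
proof -
  \<comment> \<open>Keeping \<alpha> inside \<open>T\<close> makes the bound on its absolute value
    independent of the sign of \<alpha>.\<close>
  define T where "T = (\<lambda>\<mu>. \<alpha> * (\<Sum>i=1..n. tanh (\<alpha> * ((x i - \<mu>) / \<sigma>))))"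
  have T: "\<bar>T \<mu>\<bar> \<le> real n * \<bar>\<alpha>\<bar>" for \<mu>
  proof -
    have "\<bar>tanh y\<bar> \<le> 1" for y :: real
      using tanh_real_lt_1[of y] tanh_real_gt_neg1[of y] by linarith
    then have "\<bar>\<Sum>i=1..n. tanh (\<alpha> * ((x i - \<mu>) / \<sigma>))\<bar> \<le> real (card {1..n}) * 1"
      by (intro order_trans[OF sum_abs] sum_bounded_above)
    then show ?thesis
      by (simp add: T_def abs_mult mult.commute mult_left_mono)
  qed
  \<comment> \<open>With 1/\<sigma> > 0 factored out, the sign of the score is that of the
    numerator.\<close>
  have score: "bn_score_mu n \<mu> \<sigma> \<alpha> x = (real n * ((sample_mean n x - \<mu>) / \<sigma>) - T \<mu>) / \<sigma>" for \<mu>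
    by (simp add: bn_score_mu_def T_def diff_divide_distrib)
  \<comment> \<open>The offset \<sigma>|\<alpha>| makes the linear term of the numerator equal to
    n|\<alpha>| at \<open>?l\<close> and -n|\<alpha>| at \<open>?r\<close>, exactly the bound on
    \<open>T\<close>. For \<alpha> = 0 the interval shrinks to the sample mean, itself the
    root.\<close>
  let ?l = "sample_mean n x - \<sigma> * \<bar>\<alpha>\<bar>" and ?r = "sample_mean n x + \<sigma> * \<bar>\<alpha>\<bar>"
  have "\<exists>\<mu>\<ge>?l. \<mu> \<le> ?r \<and> bn_score_mu n \<mu> \<sigma> \<alpha> x = 0"
  proof (rule IVT2')
    show "bn_score_mu n ?r \<sigma> \<alpha> x \<le> 0"
      using T[of ?r] assms by (simp add: score divide_le_0_iff abs_le_iff)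
    show "0 \<le> bn_score_mu n ?l \<sigma> \<alpha> x"
      using T[of ?l] assms by (simp add: score zero_le_divide_iff abs_le_iff)
    show "?l \<le> ?r"
      using assms by simp
    show "continuous_on {?l..?r} (\<lambda>\<mu>. bn_score_mu n \<mu> \<sigma> \<alpha> x)"
      unfolding bn_score_mu_def using assms
      by (intro continuous_intros) (auto simp: less_imp_neq cosh_real_nonzero)
  qed
  then show ?thesis by blast
qed

theorem proposition6p1:
  fixes M :: "'a measure" and X :: "nat \<Rightarrow> 'a \<Rightarrow> real"
    and n :: nat and \<mu>\<^sub>0 \<sigma> \<alpha> :: real
  assumes "n \<ge> 1" and "\<sigma> > 0"
    and "bn_random_sample M n \<mu>\<^sub>0 \<sigma> \<alpha> X"
  shows "\<forall>\<omega>\<in>space M.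
    (\<forall>\<mu>. ((\<lambda>m. bn_loglik n m \<sigma> \<alpha> (\<lambda>i. X i \<omega>)) has_real_derivative
             bn_score_mu n \<mu> \<sigma> \<alpha> (\<lambda>i. X i \<omega>)) (at \<mu>)) \<and>
    (\<exists>\<mu>. deriv (\<lambda>m. bn_loglik n m \<sigma> \<alpha> (\<lambda>i. X i \<omega>)) \<mu> = 0 \<and>
          bn_score_mu n \<mu> \<sigma> \<alpha> (\<lambda>i. X i \<omega>) = 0)"
  \<comment> \<open>Both lemmas are applied to the realised sample at each outcome.
    \<open>DERIV_imp_deriv\<close> identifies \<open>deriv\<close> with the score, so one root
    serves both equations.\<close>
  using bn_loglik_has_derivative[OF assms(1,2)] bn_score_mu_root[OF assms(2)]
  by (metis DERIV_imp_deriv)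

end
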